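(* Let $g$ be a semi-infinite matrix and, for $s=(s_1,s_2)\in\mathbb Z^2$, let $g(s)=D_{1,0}(s)\,g\,D_{2,0}(s)^{-1}$ have a Gauss--Borel factorization $g(s)=S_1(s)^{-1}S_2(s)$. Let $T_1,T_2$ be the shifts $s_1\mapsto s_1+1$ and $s_2\mapsto s_2+1$, and suppose there are matrices $q_1,q_2$ with $$T_1(D_{1,0})=q_1D_{1,0},\quad T_1(D_{2,0})=D_{2,0},\quad T_2(D_{1,0})=D_{1,0},\quad T_2(D_{2,0})=q_2D_{2,0}.$$ Put $\delta_1=S_1(s)q_1S_1(s)^{-1}$, $\delta_2=S_2(s)q_2S_2(s)^{-1}$ and suppose that $\delta_1=\delta_{1,-}^{-1}\delta_{1,+}$ and $\delta_2^{-1}=\delta_{2,-}^{-1}\delta_{2,+}$ are $LU$ factorizations. Then $$T_1(S_1(s))S_1(s)^{-1}=\delta_{1,-},\qquad T_1(S_2(s))S_2(s)^{-1}=\delta_{1,+},$$ $$T_2(S_1(s))S_1(s)^{-1}=\delta_{2,-},\qquad T_2(S_2(s))S_2(s)^{-1}=\delta_{2,+}.$$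
   Context: All matrices are semi-infinite complex matrices (in the application $g$ is the moment matrix of a quasi-definite measure on the unit circle). $D_{1,0}(s),D_{2,0}(s)$ are invertible matrices depending on $s\in\mathbb Z^2$ (discrete deformation operators). For an $s$-dependent matrix $A(s)$, $T_1(A)(s_1,s_2)=A(s_1+1,s_2)$ and $T_2(A)(s_1,s_2)=A(s_1,s_2+1)$. A Gauss--Borel ($LU$) factorization of a matrix $M$ is $M=L^{-1}U$ with $L$ lower triangular with ones on the diagonal and $U$ upper triangular with non-zero diagonal entries; it is unique when it exists. Thus $S_1(s),\delta_{1,-},\delta_{2,-}$ are lower unitriangular and $S_2(s),\delta_{1,+},\delta_{2,+}$ are invertible upper triangular. As usual in this formal setting, all products of semi-infinite matrices that occur are assumed to be well defined and associative. *)

theory Defs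
  imports Complex_Main "HOL-Library.Sublist"
begin

type_synonym cmat = "nat \<Rightarrow> nat \<Rightarrow> complex"

definition mat_one :: cmat where
  "mat_one = (\<lambda>i j. if i = j then 1 else 0)"

definition mult_defined :: "cmat \<Rightarrow> cmat \<Rightarrow> bool" where
  "mult_defined A B \<longleftrightarrow> (\<forall>i j. summable (\<lambda>k. A i k * B k j))"

text \<open>The product is meaningful only where \<open>mult_defined\<close> holds.\<close>

definition mat_mult :: "cmat \<Rightarrow> cmat \<Rightarrow> cmat" (infixl "\<odot>" 70) where
  "A \<odot> B = (\<lambda>i j. \<Sum>k. A i k * B k j)"

text \<open>
  Two-sided inverses of semi-infinite matrices need not be unique, because the product is only
  partially defined and not associative in general. Inverses are therefore a relation and not a
  function. For lower unitriangular and for invertible upper triangular matrices the two-sided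
  inverse exists, is unique, and is triangular of the same kind.
\<close>

definition mat_inverse :: "cmat \<Rightarrow> cmat \<Rightarrow> bool" where
  "mat_inverse A B \<longleftrightarrow>
     mult_defined A B \<and> mult_defined B A \<and> A \<odot> B = mat_one \<and> B \<odot> A = mat_one"

definition invertible_mat :: "cmat \<Rightarrow> bool" where
  "invertible_mat A \<longleftrightarrow> (\<exists>B. mat_inverse A B)"

definition lower_unitriangular :: "cmat \<Rightarrow> bool" where
  "lower_unitriangular L \<longleftrightarrow> (\<forall>i j. i < j \<longrightarrow> L i j = 0) \<and> (\<forall>i. L i i = 1)"

definition upper_invertible :: "cmat \<Rightarrow> bool" where
  "upper_invertible U \<longleftrightarrow> (\<forall>i j. j < i \<longrightarrow> U i j = 0) \<and> (\<forall>i. U i i \<noteq> 0)"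

text \<open>\<open>gauss_borel M L U\<close> says that \<open>M = L\<^sup>-\<^sup>1 U\<close>, so \<open>L\<close> is the inverse of the usual lower factor.\<close>

definition gauss_borel :: "cmat \<Rightarrow> cmat \<Rightarrow> cmat \<Rightarrow> bool" where
  "gauss_borel M L U \<longleftrightarrow> lower_unitriangular L \<and> upper_invertible U \<and>
     (\<exists>L'. mat_inverse L L' \<and> M = L' \<odot> U)"

text \<open>
  A product \<open>A\<^sub>1 \<cdots> A\<^sub>n\<close> is well defined and associative when, for each contiguous
  part \<open>A\<^sub>i \<cdots> A\<^sub>j\<close>, every bracketing consists of convergent products and all bracketings
  have the same value.
\<close>

datatype bracketing = Factor cmat | Times bracketing bracketing

primrec factors :: "bracketing \<Rightarrow> cmat list" where
  "factors (Factor A) = [A]"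
| "factors (Times t u) = factors t @ factors u"

primrec evaluate :: "bracketing \<Rightarrow> cmat" where
  "evaluate (Factor A) = A"
| "evaluate (Times t u) = evaluate t \<odot> evaluate u"

primrec defined_bracketing :: "bracketing \<Rightarrow> bool" where
  "defined_bracketing (Factor A) \<longleftrightarrow> True"
| "defined_bracketing (Times t u) \<longleftrightarrow>
     defined_bracketing t \<and> defined_bracketing u \<and> mult_defined (evaluate t) (evaluate u)"

definition assoc_product :: "cmat list \<Rightarrow> bool" where
  "assoc_product As \<longleftrightarrow>
     (\<forall>t. sublist (factors t) As \<longrightarrow> defined_bracketing t) \<and>
     (\<forall>t u. sublist (factors t) As \<and> factors u = factors t \<longrightarrow> evaluate t = evaluate u)"

definition T1 :: "(int \<times> int \<Rightarrow> 'a) \<Rightarrow> int \<times> int \<Rightarrow> 'a" where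
  "T1 A = (\<lambda>(s1, s2). A (s1 + 1, s2))"

definition T2 :: "(int \<times> int \<Rightarrow> 'a) \<Rightarrow> int \<times> int \<Rightarrow> 'a" where
  "T2 A = (\<lambda>(s1, s2). A (s1, s2 + 1))"

end

theory Submission
  imports Defs
begin

text \<open>
  Write \<open>M'\<close> for the shift of \<open>M\<close>. The idea is to compare two \<open>LU\<close> factorizations of the same
  matrix. A matrix \<open>M = L\<^sup>-\<^sup>1 U\<close> determines \<open>L\<close> and \<open>U\<close> already through the equation
  \<open>L M = U\<close>: every lower unitriangular \<open>P\<close> for which \<open>P M\<close> is upper triangular equals \<open>L\<close>, because
  \<open>P L\<^sup>-\<^sup>1\<close> is then both lower unitriangular and upper triangular
  (\<open>gauss_borel_unique\<close>). It therefore suffices to show, for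
  \<open>P = S\<^sub>1' S\<^sub>1\<^sup>-\<^sup>1\<close> and \<open>Q = S\<^sub>2' S\<^sub>2\<^sup>-\<^sup>1\<close>, that \<open>P \<delta>\<^sub>1 = Q\<close> under the first shift and
  \<open>P \<delta>\<^sub>2\<^sup>-\<^sup>1 = Q\<close> under the second.

  The first shift replaces \<open>g(s)\<close> by \<open>q\<^sub>1 g(s)\<close>, and conjugating by \<open>S\<^sub>1\<close> turns \<open>q\<^sub>1\<close> into \<open>\<delta>\<^sub>1\<close>.
  The second one replaces \<open>g(s)\<close> by \<open>g(s) W\<close> with \<open>W = D\<^sub>2 (D\<^sub>2\<^sup>-\<^sup>1)'\<close>. This \<open>W\<close> is a right
  inverse of \<open>q\<^sub>2\<close>, and conjugating it by \<open>S\<^sub>2\<close> gives a right inverse of \<open>\<delta>\<^sub>2\<close>, which is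
  \<open>\<delta>\<^sub>2\<^sup>-\<^sup>1\<close> by associativity.

  Products of semi-infinite matrices may diverge or fail to associate, so each regrouping needs a
  reason. There are two: a lower triangular left factor or an upper triangular right factor makes
  one of the two summations finite (\<open>mult_assoc_lower\<close>, \<open>mult_assoc_upper\<close>); the remaining
  products, which contain \<open>q\<^sub>i\<close>, \<open>D\<^sub>i\<close> and \<open>g\<close>, are covered by the assumed associativity.
\<close>

section \<open>Products with a triangular factor\<close>

definition upper_triangular :: "cmat \<Rightarrow> bool" where
  "upper_triangular U \<longleftrightarrow> (\<forall>i j. j < i \<longrightarrow> U i j = 0)"

lemma upper_invertible_imp_triangular: "upper_invertible U \<Longrightarrow> upper_triangular U"
  by (simp add: upper_invertible_def upper_triangular_def)

lemma mult_defined_lower: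
  assumes "lower_unitriangular A"
  shows "mult_defined A B"
  unfolding mult_defined_def
proof (intro allI)
  fix i j
  show "summable (\<lambda>k. A i k * B k j)"
    by (rule summable_finite[of "{..i}"]) (use assms in \<open>auto simp: lower_unitriangular_def\<close>)
qed

lemma mult_defined_upper:
  assumes "upper_triangular B"
  shows "mult_defined A B"
  unfolding mult_defined_def
proof (intro allI)
  fix i j
  show "summable (\<lambda>k. A i k * B k j)"
    by (rule summable_finite[of "{..j}"]) (use assms in \<open>auto simp: upper_triangular_def\<close>)
qed

lemma mult_lower_eq_sum:
  assumes "lower_unitriangular A"
  shows "(A \<odot> B) i j = (\<Sum>k\<le>i. A i k * B k j)"
  unfolding mat_mult_def
  by (rule suminf_finite) (use assms in \<open>auto simp: lower_unitriangular_def\<close>)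

lemma mult_upper_eq_sum:
  assumes "upper_triangular B"
  shows "(A \<odot> B) i j = (\<Sum>k\<le>j. A i k * B k j)"
  unfolding mat_mult_def
  by (rule suminf_finite) (use assms in \<open>auto simp: upper_triangular_def\<close>)

lemma mult_one_left [simp]: "mat_one \<odot> A = A"
proof (intro ext)
  fix i j
  have "(mat_one \<odot> A) i j = (\<Sum>k\<in>{i}. mat_one i k * A k j)"
    unfolding mat_mult_def by (rule suminf_finite) (auto simp: mat_one_def)
  then show "(mat_one \<odot> A) i j = A i j"
    by (simp add: mat_one_def)
qed

lemma mult_one_right [simp]: "A \<odot> mat_one = A"
proof (intro ext)
  fix i j
  have "(A \<odot> mat_one) i j = (\<Sum>k\<in>{j}. A i k * mat_one k j)"
    unfolding mat_mult_def by (rule suminf_finite) (auto simp: mat_one_def)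
  then show "(A \<odot> mat_one) i j = A i j"
    by (simp add: mat_one_def)
qed

text \<open>
  The rows of \<open>A\<close> are finite, so the outer of the two summations is a finite sum of convergent
  series and can be exchanged with the inner one.
\<close>

lemma mult_assoc_lower:
  assumes A: "lower_unitriangular A" and BC: "mult_defined B C"
  shows "(A \<odot> B) \<odot> C = A \<odot> (B \<odot> C)"
proof (intro ext)
  fix i j
  have "((A \<odot> B) \<odot> C) i j = (\<Sum>l. (A \<odot> B) i l * C l j)"
    by (simp add: mat_mult_def)
  also have "\<dots> = (\<Sum>l. \<Sum>k\<le>i. A i k * (B k l * C l j))"
    by (simp add: mult_lower_eq_sum[OF A] sum_distrib_right mult.assoc)
  also have "\<dots> = (\<Sum>k\<le>i. \<Sum>l. A i k * (B k l * C l j))"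
    by (rule suminf_sum) (use BC in \<open>auto simp: mult_defined_def intro: summable_mult\<close>)
  also have "\<dots> = (\<Sum>k\<le>i. A i k * (\<Sum>l. B k l * C l j))"
    by (intro sum.cong refl suminf_mult) (use BC in \<open>auto simp: mult_defined_def\<close>)
  also have "\<dots> = (A \<odot> (B \<odot> C)) i j"
    by (simp add: mult_lower_eq_sum[OF A] mat_mult_def[of B C])
  finally show "((A \<odot> B) \<odot> C) i j = (A \<odot> (B \<odot> C)) i j" .
qed

lemma mult_assoc_upper:
  assumes C: "upper_triangular C" and AB: "mult_defined A B"
  shows "(A \<odot> B) \<odot> C = A \<odot> (B \<odot> C)"
proof (intro ext)
  fix i j
  have "(A \<odot> (B \<odot> C)) i j = (\<Sum>k. A i k * (B \<odot> C) k j)"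
    by (simp add: mat_mult_def)
  also have "\<dots> = (\<Sum>k. \<Sum>l\<le>j. (A i k * B k l) * C l j)"
    by (simp add: mult_upper_eq_sum[OF C] sum_distrib_left mult.assoc)
  also have "\<dots> = (\<Sum>l\<le>j. \<Sum>k. (A i k * B k l) * C l j)"
    by (rule suminf_sum) (use AB in \<open>auto simp: mult_defined_def intro: summable_mult2\<close>)
  also have "\<dots> = (\<Sum>l\<le>j. (\<Sum>k. A i k * B k l) * C l j)"
    by (intro sum.cong refl suminf_mult2[symmetric]) (use AB in \<open>auto simp: mult_defined_def\<close>)
  also have "\<dots> = ((A \<odot> B) \<odot> C) i j"
    by (simp add: mult_upper_eq_sum[OF C] mat_mult_def[of A B])
  finally show "((A \<odot> B) \<odot> C) i j = (A \<odot> (B \<odot> C)) i j" by simp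
qed

section \<open>Closure of the triangular classes\<close>

lemma lower_unitriangular_mult:
  assumes A: "lower_unitriangular A" and B: "lower_unitriangular B"
  shows "lower_unitriangular (A \<odot> B)"
proof -
  have "(A \<odot> B) i i = 1" for i
  proof -
    have "(A \<odot> B) i i = (\<Sum>k\<in>{i}. A i k * B k i)"
      unfolding mult_lower_eq_sum[OF A]
      by (rule sum.mono_neutral_right) (use B in \<open>auto simp: lower_unitriangular_def\<close>)
    then show ?thesis
      using A B by (simp add: lower_unitriangular_def)
  qed
  moreover have "(A \<odot> B) i j = 0" if "i < j" for i j
    unfolding mult_lower_eq_sum[OF A]
    by (rule sum.neutral) (use B that in \<open>auto simp: lower_unitriangular_def\<close>)
  ultimately show ?thesis
    by (simp add: lower_unitriangular_def)
qed

lemma upper_triangular_mult: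
  assumes A: "upper_triangular A" and B: "upper_triangular B"
  shows "upper_triangular (A \<odot> B)"
  unfolding upper_triangular_def
proof (intro allI impI)
  fix i j :: nat
  assume "j < i"
  then have "A i k = 0" if "k \<le> j" for k
    using A that by (simp add: upper_triangular_def)
  then show "(A \<odot> B) i j = 0"
    by (simp add: mult_upper_eq_sum[OF B])
qed

text \<open>
  Forward substitution: row \<open>i\<close> of \<open>L X\<close> is row \<open>i\<close> of \<open>X\<close> plus a combination of the earlier
  rows of \<open>X\<close>, and the latter vanish in every column \<open>j \<ge> i\<close>.
\<close>

lemma lower_unitriangular_right_inverse:
  assumes L: "lower_unitriangular L" and LX: "L \<odot> X = mat_one"
  shows "lower_unitriangular X"
proof -
  have row: "X i j = mat_one i j" if "i \<le> j" for i j
    using that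
  proof (induction i rule: less_induct)
    case (less i)
    have "mat_one i j = (\<Sum>k\<le>i. L i k * X k j)"
      using mult_lower_eq_sum[OF L, of X i j] LX by simp
    also have "\<dots> = (\<Sum>k\<in>{i}. L i k * X k j)"
      by (rule sum.mono_neutral_right) (use less in \<open>auto simp: mat_one_def\<close>)
    also have "\<dots> = X i j"
      using L by (simp add: lower_unitriangular_def)
    finally show ?case by simp
  qed
  then show ?thesis
    by (simp add: lower_unitriangular_def mat_one_def)
qed

text \<open>
  The same substitution by columns. It covers the left inverse of \<open>U\<close>, where \<open>X U\<close> is the
  identity, and also the uniqueness of \<open>LU\<close> factorizations, where \<open>X U\<close> is another upper factor.
\<close>

lemma upper_triangular_cancel_right:
  assumes U: "upper_invertible U" and XU: "upper_triangular (X \<odot> U)"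
  shows "upper_triangular X"
proof -
  have "X i j = 0" if "j < i" for i j
    using that
  proof (induction j rule: less_induct)
    case (less j)
    have "0 = (\<Sum>k\<le>j. X i k * U k j)"
      using mult_upper_eq_sum[OF upper_invertible_imp_triangular[OF U], of X i j] XU less.prems
      by (simp add: upper_triangular_def)
    also have "\<dots> = (\<Sum>k\<in>{j}. X i k * U k j)"
      by (rule sum.mono_neutral_right) (use less in auto)
    finally show ?case
      using U by (auto simp: upper_invertible_def)
  qed
  then show ?thesis
    by (simp add: upper_triangular_def)
qed

lemma lower_upper_imp_one:
  assumes "lower_unitriangular A" and "upper_triangular A"
  shows "A = mat_one"
proof (intro ext)
  fix i j :: nat
  consider "i < j" | "i = j" | "j < i"
    by linarith
  then show "A i j = mat_one i j"
    using assms by cases (simp_all add: lower_unitriangular_def upper_triangular_def mat_one_def)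
qed

section \<open>Uniqueness of the Gauss--Borel factorization\<close>

lemma inverse_lower_unitriangular:
  assumes "lower_unitriangular L" and "mat_inverse L B"
  shows "lower_unitriangular B"
  using assms(1) assms(2)[unfolded mat_inverse_def]
  by (blast intro: lower_unitriangular_right_inverse)

lemma inverse_upper_triangular:
  assumes "upper_invertible U" and "mat_inverse U B"
  shows "upper_triangular B"
proof (rule upper_triangular_cancel_right)
  show "upper_invertible U" by fact
  show "upper_triangular (B \<odot> U)"
    using assms(2) by (simp add: mat_inverse_def mat_one_def upper_triangular_def)
qed

lemma inverse_lower_cancel:
  assumes L: "lower_unitriangular L" and B: "mat_inverse L B"
  shows "L \<odot> (B \<odot> X) = X" and "B \<odot> (L \<odot> X) = X"
proof -
  have B_lower: "lower_unitriangular B"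
    using L B by (rule inverse_lower_unitriangular)
  show "L \<odot> (B \<odot> X) = X" "B \<odot> (L \<odot> X) = X"
    using mult_assoc_lower[OF L mult_defined_lower[OF B_lower], of X]
      mult_assoc_lower[OF B_lower mult_defined_lower[OF L], of X] B
    by (auto simp: mat_inverse_def)
qed

lemma gauss_borel_lower_mult:
  assumes "gauss_borel M L U"
  shows "L \<odot> M = U"
  using assms by (auto simp: gauss_borel_def inverse_lower_cancel)

text \<open>
  The lower factor is the only unitriangular row reduction of \<open>M\<close> to upper triangular form. If
  \<open>P M = Q\<close>, then \<open>P L\<^sup>-\<^sup>1\<close> maps the upper factor \<open>U\<close> to \<open>Q\<close>, so it is upper as well as lower
  triangular, hence the identity.
\<close>

lemma gauss_borel_unique:
  assumes M: "gauss_borel M L U"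
    and P: "lower_unitriangular P" and Q: "upper_triangular Q" and PM: "P \<odot> M = Q"
  shows "P = L" and "Q = U"
proof -
  from M obtain B where L: "lower_unitriangular L" and U: "upper_invertible U"
    and B: "mat_inverse L B" and M_eq: "M = B \<odot> U"
    by (auto simp: gauss_borel_def)
  have B_lower: "lower_unitriangular B"
    using L B by (rule inverse_lower_unitriangular)
  have "(P \<odot> B) \<odot> U = Q"
    using mult_assoc_lower[OF P mult_defined_lower[OF B_lower]] PM M_eq by simp
  with Q have "upper_triangular (P \<odot> B)"
    using upper_triangular_cancel_right[OF U, of "P \<odot> B"] by simp
  then have PB: "P \<odot> B = mat_one"
    by (rule lower_upper_imp_one[OF lower_unitriangular_mult[OF P B_lower]])
  have "P = P \<odot> (B \<odot> L)"
    using B by (simp add: mat_inverse_def)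
  also have "\<dots> = (P \<odot> B) \<odot> L"
    using mult_assoc_lower[OF P mult_defined_lower[OF B_lower]] by simp
  finally show "P = L"
    using PB by simp
  then show "Q = U"
    using PM gauss_borel_lower_mult[OF M] by simp
qed

section \<open>The shifted factorizations\<close>

lemma assoc_product_evaluate:
  assumes "assoc_product As" and "sublist (factors t) As" and "factors u = factors t"
  shows "evaluate t = evaluate u"
  using assms unfolding assoc_product_def by blast

lemma assoc_product_defined:
  assumes "assoc_product As" and "sublist (factors (Times t u)) As"
  shows "mult_defined (evaluate t) (evaluate u)"
  using assms unfolding assoc_product_def by (metis defined_bracketing.simps(2))

text \<open>
  From \<open>M = S\<^sub>1\<^sup>-\<^sup>1 S\<^sub>2\<close> one gets
  \<open>q M = S\<^sub>1\<^sup>-\<^sup>1 (S\<^sub>1 q S\<^sub>1\<^sup>-\<^sup>1) S\<^sub>2\<close>. Factorizing the conjugate in the middle therefore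
  factorizes \<open>q M\<close>, and the old triangular factors are multiplied on the left by the new ones.
\<close>

lemma gauss_borel_left_multiplication:
  assumes M: "gauss_borel M S1 S2" and M': "gauss_borel (q \<odot> M) S1' S2'"
    and S1inv: "mat_inverse S1 S1inv" and S2inv: "mat_inverse S2 S2inv"
    and q_S1inv: "mult_defined q S1inv"
    and \<delta>: "gauss_borel (S1 \<odot> q \<odot> S1inv) L U"
  shows "S1' \<odot> S1inv = L" and "S2' \<odot> S2inv = U"
proof -
  have S1: "lower_unitriangular S1" and S2: "upper_invertible S2"
    and S1': "lower_unitriangular S1'" and S2': "upper_invertible S2'"
    using M M' by (auto simp: gauss_borel_def)
  note S2_upper = upper_invertible_imp_triangular[OF S2]
    and S2'_upper = upper_invertible_imp_triangular[OF S2']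
    and S1inv_lower = inverse_lower_unitriangular[OF S1 S1inv]
    and S2inv_upper = inverse_upper_triangular[OF S2 S2inv]
  let ?N = "q \<odot> S1inv"
  have conj: "S1 \<odot> q \<odot> S1inv = S1 \<odot> ?N"
    using mult_assoc_lower[OF S1 q_S1inv] .
  have M_eq: "M = S1inv \<odot> S2"
    using inverse_lower_cancel(2)[OF S1 S1inv, of M] gauss_borel_lower_mult[OF M] by simp
  have "S2' = S1' \<odot> (q \<odot> (S1inv \<odot> S2))"
    using gauss_borel_lower_mult[OF M'] M_eq by simp
  also have "\<dots> = S1' \<odot> (?N \<odot> S2)"
    by (simp add: mult_assoc_upper[OF S2_upper q_S1inv])
  also have "\<dots> = (S1' \<odot> ?N) \<odot> S2"
    by (simp add: mult_assoc_upper[OF S2_upper mult_defined_lower[OF S1']])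
  finally have "S2' \<odot> S2inv = ((S1' \<odot> ?N) \<odot> S2) \<odot> S2inv"
    by simp
  also have "\<dots> = S1' \<odot> ?N"
    using mult_assoc_upper[OF S2inv_upper mult_defined_upper[OF S2_upper], of "S1' \<odot> ?N"] S2inv
    by (simp add: mat_inverse_def)
  also have "\<dots> = S1' \<odot> (S1inv \<odot> (S1 \<odot> ?N))"
    by (simp add: inverse_lower_cancel(2)[OF S1 S1inv])
  also have "\<dots> = (S1' \<odot> S1inv) \<odot> (S1 \<odot> q \<odot> S1inv)"
    by (simp add: conj mult_assoc_lower[OF S1' mult_defined_lower[OF S1inv_lower]])
  finally have "(S1' \<odot> S1inv) \<odot> (S1 \<odot> q \<odot> S1inv) = S2' \<odot> S2inv" ..
  then show "S1' \<odot> S1inv = L" "S2' \<odot> S2inv = U"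
    using gauss_borel_unique[OF \<delta> lower_unitriangular_mult[OF S1' S1inv_lower]
        upper_triangular_mult[OF S2'_upper S2inv_upper]] by blast+
qed

text \<open>
  The mirror image, from \<open>M W = S\<^sub>1\<^sup>-\<^sup>1 (S\<^sub>2 W S\<^sub>2\<^sup>-\<^sup>1) S\<^sub>2\<close>: a factor on the right is
  conjugated by the upper triangular \<open>S\<^sub>2\<close> instead.
\<close>

lemma gauss_borel_right_multiplication:
  assumes M: "gauss_borel M S1 S2" and M': "gauss_borel (M \<odot> W) S1' S2'"
    and S1inv: "mat_inverse S1 S1inv" and S2inv: "mat_inverse S2 S2inv"
    and S2_W: "mult_defined S2 W" and S2_W_S2inv: "mult_defined (S2 \<odot> W) S2inv"
    and \<delta>: "gauss_borel (S2 \<odot> W \<odot> S2inv) L U"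
  shows "S1' \<odot> S1inv = L" and "S2' \<odot> S2inv = U"
proof -
  have S1: "lower_unitriangular S1" and S2: "upper_invertible S2"
    and S1': "lower_unitriangular S1'" and S2': "upper_invertible S2'"
    using M M' by (auto simp: gauss_borel_def)
  note S2'_upper = upper_invertible_imp_triangular[OF S2']
    and S1inv_lower = inverse_lower_unitriangular[OF S1 S1inv]
    and S2inv_upper = inverse_upper_triangular[OF S2 S2inv]
  note P = lower_unitriangular_mult[OF S1' S1inv_lower]
  have M_eq: "M = S1inv \<odot> S2"
    using inverse_lower_cancel(2)[OF S1 S1inv, of M] gauss_borel_lower_mult[OF M] by simp
  have "S2' = S1' \<odot> ((S1inv \<odot> S2) \<odot> W)"
    using gauss_borel_lower_mult[OF M'] M_eq by simp
  also have "\<dots> = S1' \<odot> (S1inv \<odot> (S2 \<odot> W))"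
    by (simp add: mult_assoc_lower[OF S1inv_lower S2_W])
  also have "\<dots> = (S1' \<odot> S1inv) \<odot> (S2 \<odot> W)"
    by (simp add: mult_assoc_lower[OF S1' mult_defined_lower[OF S1inv_lower]])
  finally have "S2' \<odot> S2inv = ((S1' \<odot> S1inv) \<odot> (S2 \<odot> W)) \<odot> S2inv"
    by simp
  also have "\<dots> = (S1' \<odot> S1inv) \<odot> (S2 \<odot> W \<odot> S2inv)"
    by (rule mult_assoc_lower[OF P S2_W_S2inv])
  finally have "(S1' \<odot> S1inv) \<odot> (S2 \<odot> W \<odot> S2inv) = S2' \<odot> S2inv" ..
  then show "S1' \<odot> S1inv = L" "S2' \<odot> S2inv = U"
    using gauss_borel_unique[OF \<delta> P upper_triangular_mult[OF S2'_upper S2inv_upper]] by blast+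
qed

text \<open>
  Here \<open>E\<close> is an inverse of \<open>q D\<close>, so \<open>D E\<close> inverts \<open>q\<close> from the right, and so does its conjugate
  for \<open>\<delta> = S q S\<^sup>-\<^sup>1\<close>. The product to be rebracketed is
  \<open>\<delta>\<^sup>-\<^sup>1 (S q S\<^sup>-\<^sup>1) (S D E S\<^sup>-\<^sup>1)\<close>: the first two factors cancel in one bracketing, the last two
  in another.
\<close>

lemma conjugate_inverse_eq:
  assumes S: "mat_inverse S Sinv" and \<delta>: "mat_inverse (S \<odot> q \<odot> Sinv) \<delta>inv"
    and E: "mat_inverse (q \<odot> D) E"
    and assoc: "assoc_product [\<delta>inv, S, q, Sinv, S, D, E, Sinv]"
  shows "\<delta>inv = S \<odot> (D \<odot> E) \<odot> Sinv"
proof -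
  note one = S[unfolded mat_inverse_def] \<delta>[unfolded mat_inverse_def] E[unfolded mat_inverse_def]
  let ?DE = "Times (Factor D) (Factor E)"
  let ?SS = "Times (Factor Sinv) (Factor S)"
  \<comment> \<open>\<open>D\<close> is a neighbour of \<open>q\<close> only after \<open>S\<^sup>-\<^sup>1 S\<close> has been cancelled between them.\<close>
  have "q \<odot> (D \<odot> E) = evaluate (Times (Factor q) (Times ?SS ?DE))"
    by (simp add: one)
  also have "\<dots> = evaluate (Times (Times (Factor q) (Times ?SS (Factor D))) (Factor E))"
    by (rule assoc_product_evaluate[OF assoc]) (simp_all add: sublist_code)
  also have "\<dots> = mat_one"
    by (simp add: one)
  finally have q_DE: "q \<odot> (D \<odot> E) = mat_one" .
  have "\<delta>inv = evaluate (Times (Factor \<delta>inv)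
      (Times (Times (Factor S) (Times (Factor q) (Times ?SS ?DE))) (Factor Sinv)))"
    by (simp add: one q_DE)
  also have "\<dots> = evaluate (Times (Times (Factor \<delta>inv)
        (Times (Times (Factor S) (Factor q)) (Factor Sinv)))
      (Times (Times (Factor S) ?DE) (Factor Sinv)))"
    by (rule assoc_product_evaluate[OF assoc]) (simp_all add: sublist_code)
  also have "\<dots> = S \<odot> (D \<odot> E) \<odot> Sinv"
    by (simp add: one)
  finally show ?thesis .
qed

text \<open>
  Two-sided inverses of semi-infinite matrices need not be unique. This is why the first shift,
  although it fixes \<open>D\<^sub>2\<close>, is not known to fix the chosen inverse of \<open>D\<^sub>2\<close> without associativity.
\<close>

lemma mat_inverse_unique:
  assumes "mat_inverse D E" and "mat_inverse D F" and assoc: "assoc_product [E, D, F]"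
  shows "E = F"
proof -
  have "evaluate (Times (Times (Factor E) (Factor D)) (Factor F))
      = evaluate (Times (Factor E) (Times (Factor D) (Factor F)))"
    by (rule assoc_product_evaluate[OF assoc]) simp_all
  then show ?thesis
    using assms(1,2) by (simp add: mat_inverse_def)
qed

theorem proposition29:
  fixes g :: cmat
    and D1 D2 D2inv gs S1 S1inv S2 S2inv q1 q2 :: "int \<times> int \<Rightarrow> cmat"
    and \<delta>1 \<delta>1m \<delta>1p \<delta>2 \<delta>2inv \<delta>2m \<delta>2p :: "int \<times> int \<Rightarrow> cmat"
  assumes D1_invertible: "\<And>s. invertible_mat (D1 s)"
    and D2_inverse: "\<And>s. mat_inverse (D2 s) (D2inv s)"
    and g_def: "\<And>s. gs s = D1 s \<odot> g \<odot> D2inv s"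
    and g_factorization: "\<And>s. gauss_borel (gs s) (S1 s) (S2 s)"
    and S1_inverse: "\<And>s. mat_inverse (S1 s) (S1inv s)"
    and S2_inverse: "\<And>s. mat_inverse (S2 s) (S2inv s)"
    and T1_D1: "\<And>s. T1 D1 s = q1 s \<odot> D1 s"
    and T1_D2: "\<And>s. T1 D2 s = D2 s"
    and T2_D1: "\<And>s. T2 D1 s = D1 s"
    and T2_D2: "\<And>s. T2 D2 s = q2 s \<odot> D2 s"
    and \<delta>1_def: "\<And>s. \<delta>1 s = S1 s \<odot> q1 s \<odot> S1inv s"
    and \<delta>2_def: "\<And>s. \<delta>2 s = S2 s \<odot> q2 s \<odot> S2inv s"
    and \<delta>1_factorization: "\<And>s. gauss_borel (\<delta>1 s) (\<delta>1m s) (\<delta>1p s)"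
    and \<delta>2_inverse: "\<And>s. mat_inverse (\<delta>2 s) (\<delta>2inv s)"
    and \<delta>2_factorization: "\<And>s. gauss_borel (\<delta>2inv s) (\<delta>2m s) (\<delta>2p s)"
    and assoc_T1_g: "\<And>s. assoc_product [q1 s, D1 s, g, D2inv s]"
    and assoc_T1_D2inv: "\<And>s. assoc_product [T1 D2inv s, D2 s, D2inv s]"
    and assoc_T2_g: "\<And>s. assoc_product [D1 s, g, D2inv s, D2 s, T2 D2inv s]"
    and assoc_\<delta>1: "\<And>s. assoc_product [S1 s, q1 s, S1inv s]"
    and assoc_\<delta>2: "\<And>s. assoc_product
          [\<delta>2inv s, S2 s, q2 s, S2inv s, S2 s, D2 s, T2 D2inv s, S2inv s]"
  shows "(\<forall>s. T1 S1 s \<odot> S1inv s = \<delta>1m s) \<and>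
    (\<forall>s. T1 S2 s \<odot> S2inv s = \<delta>1p s) \<and>
    (\<forall>s. T2 S1 s \<odot> S1inv s = \<delta>2m s) \<and>
    (\<forall>s. T2 S2 s \<odot> S2inv s = \<delta>2p s)"
proof (intro conjI allI)
  fix s :: "int \<times> int"
  define s' where "s' = (fst s + 1, snd s)"
  have T1_eq: "T1 A s = A s'" for A :: "int \<times> int \<Rightarrow> cmat"
    by (simp add: T1_def s'_def case_prod_unfold)
  have "mat_inverse (D2 s) (D2inv s')"
    using D2_inverse[of s'] T1_D2[of s] by (simp add: T1_eq)
  then have D2inv_eq: "D2inv s' = D2inv s"
    using D2_inverse assoc_T1_D2inv[of s, unfolded T1_eq] by (rule mat_inverse_unique)
  have "evaluate (Times (Times (Times (Factor (q1 s)) (Factor (D1 s))) (Factor g))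
          (Factor (D2inv s)))
      = evaluate (Times (Factor (q1 s))
          (Times (Times (Factor (D1 s)) (Factor g)) (Factor (D2inv s))))"
    by (rule assoc_product_evaluate[OF assoc_T1_g[of s]]) simp_all
  then have "gs s' = q1 s \<odot> gs s"
    using T1_D1[of s] by (simp add: T1_eq g_def D2inv_eq)
  then have "gauss_borel (q1 s \<odot> gs s) (S1 s') (S2 s')"
    using g_factorization[of s'] by simp
  moreover have "mult_defined (q1 s) (S1inv s)"
    using assoc_product_defined[OF assoc_\<delta>1[of s], of "Factor (q1 s)" "Factor (S1inv s)"]
    by (simp add: sublist_code)
  ultimately have eqs: "S1 s' \<odot> S1inv s = \<delta>1m s" "S2 s' \<odot> S2inv s = \<delta>1p s"
    using gauss_borel_left_multiplication[OF g_factorization _ S1_inverse S2_inverse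
        _ \<delta>1_factorization[unfolded \<delta>1_def]] by blast+
  show "T1 S1 s \<odot> S1inv s = \<delta>1m s" "T1 S2 s \<odot> S2inv s = \<delta>1p s"
    using eqs by (simp_all add: T1_eq)
next
  fix s :: "int \<times> int"
  define s' where "s' = (fst s, snd s + 1)"
  have T2_eq: "T2 A s = A s'" for A :: "int \<times> int \<Rightarrow> cmat"
    by (simp add: T2_def s'_def case_prod_unfold)
  let ?W = "D2 s \<odot> D2inv s'"
  have D2inv_shift: "mat_inverse (q2 s \<odot> D2 s) (D2inv s')"
    using D2_inverse[of s'] T2_D2[of s] by (simp add: T2_eq)
  note assoc = assoc_\<delta>2[of s, unfolded T2_eq]
  \<comment> \<open>Inserting \<open>D\<^sub>2\<^sup>-\<^sup>1 D\<^sub>2\<close> before the shifted inverse exhibits the old moment matrix.\<close>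
  have "evaluate (Times (Times (Factor (D1 s)) (Factor g))
          (Times (Times (Factor (D2inv s)) (Factor (D2 s))) (Factor (D2inv s'))))
      = evaluate (Times (Times (Times (Factor (D1 s)) (Factor g)) (Factor (D2inv s)))
          (Times (Factor (D2 s)) (Factor (D2inv s'))))"
    by (rule assoc_product_evaluate[OF assoc_T2_g[of s, unfolded T2_eq]]) simp_all
  then have "gs s' = gs s \<odot> ?W"
    using T2_D1[of s] D2_inverse[of s] by (simp add: T2_eq g_def mat_inverse_def)
  then have shifted: "gauss_borel (gs s \<odot> ?W) (S1 s') (S2 s')"
    using g_factorization[of s'] by simp
  have "\<delta>2inv s = S2 s \<odot> ?W \<odot> S2inv s"
    using conjugate_inverse_eq[OF S2_inverse \<delta>2_inverse[unfolded \<delta>2_def] D2inv_shift assoc] .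
  then have factorization: "gauss_borel (S2 s \<odot> ?W \<odot> S2inv s) (\<delta>2m s) (\<delta>2p s)"
    using \<delta>2_factorization[of s] by simp
  have S2_W: "mult_defined (S2 s) ?W"
    using assoc_product_defined[OF assoc, of "Factor (S2 s)"
        "Times (Factor (D2 s)) (Factor (D2inv s'))"]
    by (simp add: sublist_code)
  have S2_W_S2inv: "mult_defined (S2 s \<odot> ?W) (S2inv s)"
    using assoc_product_defined[OF assoc, of "Times (Factor (S2 s))
        (Times (Factor (D2 s)) (Factor (D2inv s')))" "Factor (S2inv s)"]
    by (simp add: sublist_code)
  note eqs = gauss_borel_right_multiplication[OF g_factorization shifted S1_inverse S2_inverse
      S2_W S2_W_S2inv factorization]
  show "T2 S1 s \<odot> S1inv s = \<delta>2m s" "T2 S2 s \<odot> S2inv s = \<delta>2p s"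
    using eqs by (simp_all add: T2_eq)
qed

end
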